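(* Let $d\ge 1$ and let $S\subset\mathbb{R}^d$ be a finite generic set of points. For a triangulation $t$ of $S$ with $d$-simplices $\Delta_i$, where $\Delta_i$ has vertices $x_{i0},\dots,x_{id}$, let $$V(t)=\sum_i \left(\|x_{i0}\|^2+\dots+\|x_{id}\|^2\right)\mathrm{vol}(\Delta_i).$$ Then a triangulation $t$ of $S$ minimizes $V$ over all triangulations of $S$ if and only if $t$ is the Delaunay triangulation of $S$.
   Context: A finite set $S\subset\mathbb{R}^d$ is called generic if it affinely spans $\mathbb{R}^d$ and no $d+2$ of its points lie on a common sphere. A triangulation of $S$ is a finite collection of nondegenerate $d$-simplices whose union is the convex hull of $S$, any two of which intersect in a common (possibly empty) face, and whose set of vertices is exactly $S$. The Delaunay triangulation of a generic $S$ is the straight-line dual of the Voronoi diagram of $S$: its $d$-simplices are the convex hulls of those $(d+1)$-element subsets of $S$ whose Voronoi cells have a common point, where the Voronoi cell of $p\in S$ is $\{x\in\mathbb{R}^d : \|x-p\|\le\|x-q\| \text{ for all } q\in S\}$; equivalently, its simplices are the nondegenerate $d$-simplices with vertices in $S$ whose circumscribed open ball contains no point of $S$. $\|\cdot\|$ is the Euclidean norm and $\mathrm{vol}$ is $d$-dimensional volume. *)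

theory Defs
  imports "HOL-Analysis.Analysis"
begin

(* A radius r < 0 or r = 0 is harmless here: such a sphere has at most one point,
   while T has at least three. *)
definition generic :: "'a::euclidean_space set \<Rightarrow> bool" where
  "generic S \<longleftrightarrow> finite S \<and> affine hull S = UNIV \<and>
     \<not> (\<exists>T c r. T \<subseteq> S \<and> card T = DIM('a) + 2 \<and> T \<subseteq> sphere c r)"

definition vertices :: "'a::euclidean_space set \<Rightarrow> 'a set" where
  "vertices \<Delta> = {x. x extreme_point_of \<Delta>}"

(* A triangulation is given by its top-dimensional simplices only.  The library predicate
   triangulation supplies finiteness and the condition that any two members intersect in
   a common face, the empty set being a face. *)
definition triangulation_of :: "'a::euclidean_space set \<Rightarrow> 'a set set \<Rightarrow> bool" where
  "triangulation_of S t \<longleftrightarrow>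
     triangulation t \<and>
     (\<forall>\<Delta>\<in>t. int DIM('a) simplex \<Delta>) \<and>
     \<Union>t = convex hull S \<and>
     (\<Union>\<Delta>\<in>t. vertices \<Delta>) = S"

definition voronoi_cell :: "'a::euclidean_space set \<Rightarrow> 'a \<Rightarrow> 'a set" where
  "voronoi_cell S p = {x. \<forall>q\<in>S. norm (x - p) \<le> norm (x - q)}"

(* For generic S, any d + 1 points of S whose Voronoi cells meet lie on a common sphere
   and hence are affinely independent: otherwise that sphere could be replaced by one
   through a further point of S.  So nondegeneracy need not be required separately. *)
definition delaunay :: "'a::euclidean_space set \<Rightarrow> 'a set set" where
  "delaunay S = {convex hull C | C.
     C \<subseteq> S \<and> card C = DIM('a) + 1 \<and> (\<Inter>p\<in>C. voronoi_cell S p) \<noteq> {}}"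

definition V :: "'a::euclidean_space set set \<Rightarrow> real" where
  "V t = (\<Sum>\<Delta>\<in>t. (\<Sum>x\<in>vertices \<Delta>. (norm x)\<^sup>2) * measure lebesgue \<Delta>)"

end

theory Submission
  imports Defs
begin

text \<open>Lift \<open>x\<close> to the paraboloid. Interpolating \<open>x \<mapsto> \<parallel>x\<parallel>\<^sup>2\<close> affinely on each simplex
  of \<open>t\<close> gives a piecewise affine function on the convex hull of \<open>S\<close>, and \<open>V t\<close> is \<open>d + 1\<close> times
  its integral, because each barycentric coordinate has mean \<open>1 / (d + 1)\<close>. The empty sphere around
  a Delaunay simplex says that its interpolant lies strictly below the paraboloid at all other
  points of \<open>S\<close>. Hence the Delaunay interpolant is the lower convex envelope of the lifted points:
  it is pointwise minimal, and strictly smaller on the interior of an overlap with a different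
  simplex.\<close>

section \<open>Lower facets of the lifted point set\<close>

text \<open>The comparison presupposes that \<open>delaunay S\<close> is itself a triangulation, and
  there genericity does its work: it allows at most \<open>d + 1\<close> points of \<open>S\<close>
  on a sphere and makes \<open>d + 1\<close> cospherical points affinely independent. Common faces
  and strict minimality both come from one fact: a weighted average of nonnegative gaps to a
  supporting affine function vanishes only if every weighted gap does. The mean of a barycentric
  coordinate is found without coordinates on the simplex: each mean is at least
  \<open>1 / (d + 1)\<close>, there are \<open>d + 1\<close> of them, and they add up to 1. No
  global interpolant is formed, since neighbouring simplices would have to be reconciled along
  shared faces; differences are integrated over the pairwise overlaps of the two triangulations
  instead.\<close>

lemma affine_extension_exists:
  fixes C :: "'a::euclidean_space set" and f :: "'a \<Rightarrow> real"
  assumes "\<not> affine_dependent C"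
  obtains a b where "\<And>q. q \<in> C \<Longrightarrow> a \<bullet> q + b = f q"
proof (cases "C = {}")
  case True
  then show ?thesis using that by blast
next
  case False
  then obtain p where p: "p \<in> C" by blast
  have ind: "independent ((\<lambda>x. -p + x) ` (C - {p}))"
    using assms affine_dependent_iff_dependent2[OF p] by simp
  obtain g :: "'a \<Rightarrow> real" where g: "linear g"
    "\<forall>x\<in>(\<lambda>x. -p + x) ` (C - {p}). g x = f (p + x) - f p"
    using linear_independent_extend[OF ind, of "\<lambda>x. f (p + x) - f p"] by blast
  \<comment> \<open>\<open>adjoint g 1\<close> is the vector that represents the functional
    \<open>g\<close>.\<close>
  have gi: "g x = adjoint g 1 \<bullet> x" for x
    using adjoint_works[OF g(1), of x 1] by (simp add: inner_commute)
  have "g (q - p) = f q - f p" if "q \<in> C" for q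
    using g(2) that linear_0[OF g(1)] by (cases "q = p") auto
  then have "adjoint g 1 \<bullet> q = f q - f p + adjoint g 1 \<bullet> p" if "q \<in> C" for q
    using that by (simp add: gi inner_diff_right algebra_simps)
  then show ?thesis
    by (intro that[of "adjoint g 1" "f p - g p"]) (simp add: gi)
qed

lemma affine_functions_eqI:
  fixes a a' :: "'a::euclidean_space"
  assumes "affine hull C = UNIV" "\<And>q. q \<in> C \<Longrightarrow> a \<bullet> q + b = a' \<bullet> q + b'"
  shows "a \<bullet> x + b = a' \<bullet> x + b'"
proof -
  have "affine hull C \<subseteq> {x. (a - a') \<bullet> x = b' - b}"
  proof (rule hull_minimal)
    show "C \<subseteq> {x. (a - a') \<bullet> x = b' - b}"
      using assms(2) by (auto simp: inner_diff_left algebra_simps)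
  qed (rule affine_hyperplane)
  then have "x \<in> {x. (a - a') \<bullet> x = b' - b}"
    using assms(1) by blast
  then show ?thesis by (simp add: inner_diff_left)
qed

lemma affine_combination:
  fixes a :: "'a::real_inner"
  assumes "sum u C = 1"
  shows "a \<bullet> (\<Sum>q\<in>C. u q *\<^sub>R q) + b = (\<Sum>q\<in>C. u q * (a \<bullet> q + b))"
  by (simp add: inner_sum_right distrib_left sum.distrib sum_distrib_right[symmetric] assms)

lemma norm_diff_square:
  fixes q c :: "'a::real_inner"
  shows "(norm (q - c))\<^sup>2 = (norm q)\<^sup>2 - 2 * (c \<bullet> q) + (norm c)\<^sup>2"
  by (simp add: power2_norm_eq_inner inner_diff inner_commute)

text \<open>The empty-sphere condition after lifting: for \<open>a = 2 *\<^sub>R c\<close> and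
  \<open>b = r\<^sup>2 - (norm c)\<^sup>2\<close> the gap
  \<open>(norm q)\<^sup>2 - (a \<bullet> q + b)\<close> equals
  \<open>(norm (q - c))\<^sup>2 - r\<^sup>2\<close>. Strictness off \<open>C\<close> makes
  \<open>C\<close> the full set of contact points.\<close>

definition lower_facet :: "'a::euclidean_space set \<Rightarrow> 'a set \<Rightarrow> 'a \<Rightarrow> real \<Rightarrow> bool" where
  "lower_facet S C a b \<longleftrightarrow> C \<subseteq> S \<and> (\<forall>q\<in>C. a \<bullet> q + b = (norm q)\<^sup>2) \<and>
     (\<forall>q\<in>S - C. a \<bullet> q + b < (norm q)\<^sup>2)"

lemma lower_facet_le:
  assumes "lower_facet S C a b" "q \<in> S"
  shows "a \<bullet> q + b \<le> (norm q)\<^sup>2"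
  using assms unfolding lower_facet_def by (cases "q \<in> C") (auto simp: less_imp_le)

lemma lower_facet_eq_iff:
  assumes "lower_facet S C a b" "q \<in> S"
  shows "a \<bullet> q + b = (norm q)\<^sup>2 \<longleftrightarrow> q \<in> C"
  using assms unfolding lower_facet_def by (metis Diff_iff less_irrefl)

lemma lower_facet_combination_le:
  assumes "lower_facet S C a b" "T \<subseteq> S" "\<And>q. q \<in> T \<Longrightarrow> 0 \<le> u q" "sum u T = 1"
  shows "a \<bullet> (\<Sum>q\<in>T. u q *\<^sub>R q) + b \<le> (\<Sum>q\<in>T. u q * (norm q)\<^sup>2)"
  unfolding affine_combination[OF assms(4)]
  using assms by (intro sum_mono mult_left_mono lower_facet_le[OF assms(1)]) auto

text \<open>The two sides differ by a weighted sum of gaps, which are nonnegative on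
  \<open>S\<close> and positive off \<open>C\<close>; hence each weighted gap is 0.\<close>

lemma lower_facet_combination_eq:
  assumes lf: "lower_facet S C a b" and "T \<subseteq> S" "finite T" "\<And>q. q \<in> T \<Longrightarrow> 0 \<le> u q" "sum u T = 1"
    and eq: "a \<bullet> (\<Sum>q\<in>T. u q *\<^sub>R q) + b = (\<Sum>q\<in>T. u q * (norm q)\<^sup>2)"
    and "q \<in> T" "q \<notin> C"
  shows "u q = 0"
proof -
  have "(\<Sum>q\<in>T. u q * ((norm q)\<^sup>2 - (a \<bullet> q + b))) = 0"
    using eq unfolding affine_combination[OF assms(5)] by (simp add: right_diff_distrib sum_subtractf)
  moreover have "0 \<le> u q * ((norm q)\<^sup>2 - (a \<bullet> q + b))" if "q \<in> T" for q
    using assms that lower_facet_le[OF lf] by (metis diff_ge_0_iff_ge mult_nonneg_nonneg subsetD)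
  ultimately have "u q * ((norm q)\<^sup>2 - (a \<bullet> q + b)) = 0"
    using assms(3,7) by (metis (no_types, lifting) sum_nonneg_eq_0_iff)
  then show ?thesis
    using lower_facet_eq_iff[OF lf, of q] assms(2,7,8) by auto
qed

section \<open>General position and empty spheres\<close>

lemma generic_finite: "generic S \<Longrightarrow> finite S"
  by (simp add: generic_def)

lemma generic_sphere_card:
  fixes S :: "'a::euclidean_space set"
  assumes "generic S" "T \<subseteq> S" "T \<subseteq> sphere c r"
  shows "card T \<le> DIM('a) + 1"
proof (rule ccontr)
  assume "\<not> card T \<le> DIM('a) + 1"
  then obtain T' where "T' \<subseteq> T" "card T' = DIM('a) + 2"
    by (metis obtain_subset_with_card_n add_2_eq_Suc' add.commute plus_1_eq_Suc not_less_eq_eq)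
  then show False
    using assms unfolding generic_def by (meson subset_trans)
qed

text \<open>Dependence would put the \<open>d + 1\<close> points into a hyperplane, which leaves a
  one-parameter family of spheres through them. Since \<open>S\<close> spans the space, it has a
  point off the hyperplane, and some sphere of the family picks it up as a forbidden further
  point.\<close>

lemma generic_cospherical_affine_independent:
  fixes S :: "'a::euclidean_space set"
  assumes S: "generic S" and C: "C \<subseteq> S" "card C = DIM('a) + 1" "C \<subseteq> sphere c r"
  shows "\<not> affine_dependent C"
proof
  assume dep: "affine_dependent C"
  have fin: "finite C" using C by (metis card.infinite add_is_0 one_neq_zero)
  obtain p where p: "p \<in> C" using C(2) by fastforce
  have "aff_dim C < DIM('a)"
    using dep fin C(2) affine_independent_iff_card[of C] aff_dim_le_card[OF fin] by auto
  then obtain n \<beta> where n: "n \<noteq> 0" "C \<subseteq> {x. n \<bullet> x = \<beta>}"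
    using aff_lowdim_subset_hyperplane by blast
  have "\<not> S \<subseteq> {x. n \<bullet> x = \<beta>}"
  proof
    assume "S \<subseteq> {x. n \<bullet> x = \<beta>}"
    then have "affine hull S \<subseteq> {x. n \<bullet> x = \<beta>}"
      by (intro hull_minimal affine_hyperplane)
    then have *: "n \<bullet> x = \<beta>" for x using S by (auto simp: generic_def)
    have "n \<bullet> n = n \<bullet> 0" using *[of n] *[of 0] by simp
    with n(1) show False by simp
  qed
  then obtain q where q: "q \<in> S" "n \<bullet> q \<noteq> \<beta>" by blast
  \<comment> \<open>Moving the centre along the normal \<open>n\<close> keeps it equidistant from \<open>C\<close>, and a suitable
    amount makes the sphere pass through \<open>q\<close> as well.\<close>
  define s where "s = ((norm (q - c))\<^sup>2 - (norm (p - c))\<^sup>2) / (2 * (n \<bullet> q - \<beta>))"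
  define c' where "c' = c + s *\<^sub>R n"
  \<comment> \<open>The last bracket does not depend on \<open>x\<close>, and
    \<open>n \<bullet> x\<close> is constant on \<open>C\<close>; only for points off the hyperplane
    does \<open>s\<close> change the distance relative to \<open>C\<close>.\<close>
  have dist': "(norm (x - c'))\<^sup>2 = (norm (x - c))\<^sup>2 - 2 * s * (n \<bullet> x) + (2 * s * (n \<bullet> c) + s\<^sup>2 * (norm n)\<^sup>2)" for x
    unfolding c'_def power2_norm_eq_inner
    by (simp add: inner_diff inner_add inner_commute algebra_simps power2_eq_square)
  have 1: "(norm (x - c'))\<^sup>2 = (norm (p - c'))\<^sup>2" if "x \<in> C" for x
  proof -
    have "norm (x - c) = norm (p - c)"
      using subsetD[OF C(3) that] subsetD[OF C(3) p] by (simp add: dist_norm norm_minus_commute)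
    moreover have "n \<bullet> x = n \<bullet> p" using that p n(2) by auto
    ultimately show ?thesis by (simp only: dist')
  qed
  have "s * (2 * (n \<bullet> q - \<beta>)) = (norm (q - c))\<^sup>2 - (norm (p - c))\<^sup>2"
    using nonzero_eq_divide_eq[of "2 * (n \<bullet> q - \<beta>)" s] q(2) s_def by simp
  moreover have "n \<bullet> p = \<beta>" using p n(2) by auto
  ultimately have 2: "(norm (q - c'))\<^sup>2 = (norm (p - c'))\<^sup>2"
    by (simp add: dist' algebra_simps)
  have "insert q C \<subseteq> sphere c' (norm (p - c'))"
    using 1 2 by (auto simp: dist_norm norm_minus_commute)
  then have "card (insert q C) \<le> DIM('a) + 1"
    using generic_sphere_card[OF S, of "insert q C"] C q by blast
  moreover have "q \<notin> C" using q n(2) by auto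
  ultimately show False using fin C(2) by simp
qed

text \<open>With \<open>d + 1\<close> points of \<open>C\<close> on it, the sphere has no room for
  another point of \<open>S\<close>. This turns the weak bound \<open>r \<le> norm (q - c)\<close>
  into the strict inequality needed off \<open>C\<close>.\<close>

lemma lower_facet_if_empty_sphere:
  fixes S :: "'a::euclidean_space set"
  assumes S: "generic S" and C: "C \<subseteq> S" "card C = DIM('a) + 1"
    and r: "\<And>p. p \<in> C \<Longrightarrow> norm (p - c) = r" "\<And>q. q \<in> S \<Longrightarrow> r \<le> norm (q - c)"
  shows "lower_facet S C (2 *\<^sub>R c) (r\<^sup>2 - (norm c)\<^sup>2)"
proof -
  have fin: "finite C" using C by (metis card.infinite add_is_0 one_neq_zero)
  have Csph: "C \<subseteq> sphere c r" using r(1) by (auto simp: dist_norm norm_minus_commute)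
  obtain p where "p \<in> C" using C(2) by fastforce
  then have r0: "0 \<le> r" using r(1) by (metis norm_ge_zero)
  have "r < norm (q - c)" if "q \<in> S - C" for q
  proof (rule ccontr)
    assume "\<not> r < norm (q - c)"
    with r(2) that have "norm (q - c) = r" by fastforce
    then have "insert q C \<subseteq> sphere c r" using Csph by (auto simp: dist_norm norm_minus_commute)
    then have "card (insert q C) \<le> DIM('a) + 1"
      using generic_sphere_card[OF S, of "insert q C"] C that by blast
    then show False using that fin C(2) by simp
  qed
  then have "r\<^sup>2 < (norm (q - c))\<^sup>2" if "q \<in> S - C" for q
    using that r0 by (simp add: power_strict_mono)
  moreover have "(norm (q - c))\<^sup>2 = r\<^sup>2" if "q \<in> C" for q using r(1) that by simp
  ultimately show ?thesis
    using C unfolding lower_facet_def norm_diff_square by (force simp: algebra_simps)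
qed

text \<open>A common point of the Voronoi cells has every point of \<open>C\<close> as a nearest
  point of \<open>S\<close>, so it is the centre of an empty sphere through
  \<open>C\<close>.\<close>

lemma delaunay_lower_facet:
  fixes S :: "'a::euclidean_space set"
  assumes S: "generic S" and E: "E \<in> delaunay S"
  obtains C a b where "E = convex hull C" "\<not> affine_dependent C" "card C = DIM('a) + 1"
    "lower_facet S C a b"
proof -
  obtain C c where C: "E = convex hull C" "C \<subseteq> S" "card C = DIM('a) + 1"
    and c: "\<And>p. p \<in> C \<Longrightarrow> c \<in> voronoi_cell S p"
    using E unfolding delaunay_def by blast
  obtain p where p: "p \<in> C" using C(3) by fastforce
  have le: "norm (p' - c) \<le> norm (q - c)" if "p' \<in> C" "q \<in> S" for p' q
    using c[OF that(1)] that(2) by (simp add: voronoi_cell_def norm_minus_commute[of c])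
  have 1: "norm (q - c) = norm (p - c)" if "q \<in> C" for q
    using le[of q p] le[of p q] C(2) p that by force
  have 2: "norm (p - c) \<le> norm (q - c)" if "q \<in> S" for q
    using le[OF p that] .
  have "C \<subseteq> sphere c (norm (p - c))" using 1 by (auto simp: dist_norm norm_minus_commute)
  then have "\<not> affine_dependent C"
    using generic_cospherical_affine_independent[OF S C(2,3)] by blast
  with C that lower_facet_if_empty_sphere[OF S C(2,3) 1 2] show thesis by blast
qed

text \<open>Over its own hull a facet function dominates every other one, so the two functions agree
  on the intersection. A representation of such a point by \<open>C\<close> is then an equality case
  for the other facet, and the weights off \<open>C'\<close> vanish.\<close>

lemma convex_hull_Int_lower_facets:
  assumes S: "finite S" and lf: "lower_facet S C a b" "lower_facet S C' a' b'"
  shows "convex hull C \<inter> convex hull C' = convex hull (C \<inter> C')"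
proof
  show "convex hull (C \<inter> C') \<subseteq> convex hull C \<inter> convex hull C'"
    by (simp add: hull_mono)
next
  have *: "a' \<bullet> x + b' \<le> a \<bullet> x + b"
    if lf: "lower_facet S C a b" "lower_facet S C' a' b'" and x: "x \<in> convex hull C"
    for C C' a a' b b' x
  proof -
    have C: "C \<subseteq> S" "finite C" using lf(1) S by (auto simp: lower_facet_def finite_subset)
    obtain u where u: "\<forall>q\<in>C. 0 \<le> u q" "sum u C = 1" "(\<Sum>q\<in>C. u q *\<^sub>R q) = x"
      using x by (auto simp: convex_hull_finite[OF C(2)])
    have "a' \<bullet> x + b' \<le> (\<Sum>q\<in>C. u q * (norm q)\<^sup>2)"
      using lower_facet_combination_le[OF lf(2) C(1), of u] u by auto
    also have "\<dots> = a \<bullet> x + b"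
      unfolding u(3)[symmetric] affine_combination[OF u(2)]
      using lf(1) by (intro sum.cong) (auto simp: lower_facet_def)
    finally show ?thesis .
  qed
  show "convex hull C \<inter> convex hull C' \<subseteq> convex hull (C \<inter> C')"
  proof
    fix x assume x: "x \<in> convex hull C \<inter> convex hull C'"
    have eq: "a' \<bullet> x + b' = a \<bullet> x + b"
      using *[OF lf, of x] *[OF lf(2,1), of x] x by simp
    have C: "C \<subseteq> S" "finite C" using lf(1) S by (auto simp: lower_facet_def finite_subset)
    obtain u where u: "\<forall>q\<in>C. 0 \<le> u q" "sum u C = 1" "(\<Sum>q\<in>C. u q *\<^sub>R q) = x"
      using x by (auto simp: convex_hull_finite[OF C(2)])
    have "(\<Sum>q\<in>C. u q * (norm q)\<^sup>2) = a \<bullet> x + b"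
      unfolding u(3)[symmetric] affine_combination[OF u(2)]
      using lf(1) by (intro sum.cong) (auto simp: lower_facet_def)
    then have zero: "u q = 0" if "q \<in> C" "q \<notin> C'" for q
      using lower_facet_combination_eq[OF lf(2) C, of u q] u eq that by auto
    have "sum u (C \<inter> C') = 1" "(\<Sum>q\<in>C \<inter> C'. u q *\<^sub>R q) = x"
      unfolding u(2,3)[symmetric] using C zero
      by (intro sum.mono_neutral_left; auto)+
    then show "x \<in> convex hull (C \<inter> C')"
      using u(1) C(2) by (auto simp: convex_hull_finite)
  qed
qed

text \<open>Jensen's inequality puts the facet function at \<open>p\<close> on or above the
  paraboloid, and support puts it on or below. Thus a point of \<open>S\<close> lying in a Delaunay
  simplex is one of its vertices, so that covering the hull also yields every point of
  \<open>S\<close> as a vertex.\<close>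

lemma lower_facet_contains_vertex:
  assumes S: "finite S" and lf: "lower_facet S C a b" and p: "p \<in> S" "p \<in> convex hull C"
  shows "p \<in> C"
proof -
  have C: "C \<subseteq> S" "finite C" using lf S by (auto simp: lower_facet_def finite_subset)
  obtain u where u: "\<forall>q\<in>C. 0 \<le> u q" "sum u C = 1" "(\<Sum>q\<in>C. u q *\<^sub>R q) = p"
    using p by (auto simp: convex_hull_finite[OF C(2)])
  have "a \<bullet> p + b = (\<Sum>q\<in>C. u q * (norm q)\<^sup>2)"
    unfolding u(3)[symmetric] affine_combination[OF u(2)]
    using lf by (intro sum.cong) (auto simp: lower_facet_def)
  \<comment> \<open>The mean of the squared norms splits into the variance about the barycentre
    \<open>p\<close> and a term that evaluates to \<open>(norm p)\<^sup>2\<close>.\<close>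
  also have "\<dots> = (\<Sum>q\<in>C. u q * (norm (q - p))\<^sup>2) + (\<Sum>q\<in>C. u q * (2 * (p \<bullet> q) - (norm p)\<^sup>2))"
    by (simp add: norm_diff_square sum.distrib[symmetric] algebra_simps)
  also have "(\<Sum>q\<in>C. u q * (2 * (p \<bullet> q) - (norm p)\<^sup>2)) = (norm p)\<^sup>2"
    using affine_combination[OF u(2), of "2 *\<^sub>R p" "- (norm p)\<^sup>2"]
    by (simp add: u(3) power2_norm_eq_inner)
  finally have "(norm p)\<^sup>2 \<le> a \<bullet> p + b"
    using u(1) by (simp add: sum_nonneg)
  then show ?thesis
    using lower_facet_le[OF lf p(1)] lower_facet_eq_iff[OF lf p(1)] by simp
qed

section \<open>The Delaunay triangulation\<close>

text \<open>A common face of two different sets is proper in at least one of them, hence of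
  dimension below \<open>d\<close>.\<close>

lemma negligible_Int_faces:
  fixes T T' :: "'a::euclidean_space set"
  assumes "convex T" "convex T'" "T \<inter> T' face_of T" "T \<inter> T' face_of T'" "T \<noteq> T'"
  shows "negligible (T \<inter> T')"
proof -
  have "aff_dim (T \<inter> T') < DIM('a)"
  proof (cases "T \<inter> T' = T")
    case True
    with assms(5) have "T \<inter> T' \<noteq> T'" by blast
    then show ?thesis
      using face_of_aff_dim_lt[OF assms(2,4)] aff_dim_le_DIM[of T'] by linarith
  next
    case False
    then show ?thesis
      using face_of_aff_dim_lt[OF assms(1,3)] aff_dim_le_DIM[of T] by linarith
  qed
  then have "interior (T \<inter> T') = {}"
    using aff_dim_nonempty_interior[of "T \<inter> T'"] by (metis less_irrefl)
  then show ?thesis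
    using assms by (simp add: negligible_convex_interior convex_Int)
qed

lemma interior_convex_hull_affine_span:
  fixes S :: "'a::euclidean_space set"
  assumes "affine hull S = UNIV"
  shows "interior (convex hull S) \<noteq> {}"
proof -
  have "S \<noteq> {}" using assms by auto
  then have "rel_interior (convex hull S) \<noteq> {}"
    by (simp add: rel_interior_eq_empty)
  then show ?thesis
    using rel_interior_interior[of "convex hull S"] assms by simp
qed

section \<open>Covering the convex hull by Delaunay simplices\<close>

lemma lifted_convex_hull_mem:
  fixes S :: "'a::euclidean_space set"
  assumes S: "finite S"
  shows "(x, e) \<in> convex hull ((\<lambda>q. (q, (norm q)\<^sup>2)) ` S) \<longleftrightarrow>
    (\<exists>u. (\<forall>q\<in>S. 0 \<le> u q) \<and> sum u S = 1 \<and> (\<Sum>q\<in>S. u q *\<^sub>R q) = x \<and>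
      (\<Sum>q\<in>S. u q * (norm q)\<^sup>2) = e)" (is "?L \<longleftrightarrow> ?R")
proof -
  let ?f = "\<lambda>q::'a. (q, (norm q)\<^sup>2)"
  have inj: "inj_on ?f S" by (auto intro: inj_onI)
  have pair: "(\<Sum>q\<in>S. u q *\<^sub>R ?f q) = (\<Sum>q\<in>S. u q *\<^sub>R q, \<Sum>q\<in>S. u q * (norm q)\<^sup>2)" for u
    by (simp add: prod_eq_iff fst_sum snd_sum)
  show ?thesis
  proof
    assume ?L
    then obtain u where "\<forall>z\<in>?f ` S. 0 \<le> u z" "sum u (?f ` S) = 1" "(\<Sum>z\<in>?f ` S. u z *\<^sub>R z) = (x, e)"
      using S by (auto simp: convex_hull_finite)
    then show ?R
      using pair[of "u \<circ> ?f"] by (intro exI[of _ "u \<circ> ?f"]) (simp add: sum.reindex[OF inj])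
  next
    assume ?R
    then obtain u where u: "\<forall>q\<in>S. 0 \<le> u q" "sum u S = 1" "(\<Sum>q\<in>S. u q *\<^sub>R q) = x"
      "(\<Sum>q\<in>S. u q * (norm q)\<^sup>2) = e" by blast
    have "(\<Sum>q\<in>S. u q *\<^sub>R ?f q) \<in> convex hull (?f ` S)"
      using S u by (intro convex_sum) (auto intro: hull_inc)
    then show ?L using u pair[of u] by simp
  qed
qed

text \<open>Separating the lifted point set from the open vertical ray below its lower boundary
  point over \<open>x\<close> gives a non-vertical supporting hyperplane, i.e. an empty sphere through
  points of \<open>S\<close> whose hull contains \<open>x\<close>.\<close>

lemma empty_sphere_around_interior_point:
  fixes S :: "'a::euclidean_space set"
  assumes S: "finite S" and x: "x \<in> interior (convex hull S)"
  obtains T c r where "T \<subseteq> S" "x \<in> convex hull T" "\<And>p. p \<in> T \<Longrightarrow> norm (p - c) = r"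
    "\<And>q. q \<in> S \<Longrightarrow> r \<le> norm (q - c)"
proof -
  define K where "K = convex hull ((\<lambda>q. (q, (norm q)\<^sup>2)) ` S)"
  note mem = lifted_convex_hull_mem[OF S, folded K_def]
  have cK: "compact K" unfolding K_def using S
    by (intro compact_convex_hull finite_imp_compact finite_imageI)
  have "x \<in> convex hull S" using x interior_subset by blast
  then obtain e0 where e0: "(x, e0) \<in> K"
    using S by (auto simp: mem convex_hull_finite)
  have cE: "compact (K \<inter> fst -` {x})"
    using cK by (intro compact_Int_closed closed_vimage_fst) auto
  obtain e where e: "(x, e) \<in> K" and emin: "\<And>e'. (x, e') \<in> K \<Longrightarrow> e \<le> e'"
  proof -
    have "\<exists>z\<in>K \<inter> fst -` {x}. \<forall>z'\<in>K \<inter> fst -` {x}. snd z \<le> snd z'"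
      using e0 by (intro continuous_attains_inf[OF cE]) (auto intro!: continuous_intros)
    then obtain z where z: "z \<in> K" "fst z = x" "\<And>z'. z' \<in> K \<Longrightarrow> fst z' = x \<Longrightarrow> snd z \<le> snd z'"
      by auto
    show thesis
    proof (rule that)
      show "(x, snd z) \<in> K" using z(1,2) by (metis prod.collapse)
      show "snd z \<le> e'" if "(x, e') \<in> K" for e' using z(3)[OF that] by simp
    qed
  qed
  obtain n \<beta> where n: "n \<noteq> 0" and ray: "\<And>z. z \<in> {x} \<times> {..<e} \<Longrightarrow> n \<bullet> z \<le> \<beta>"
    and up: "\<And>z. z \<in> K \<Longrightarrow> \<beta> \<le> n \<bullet> z"
  proof -
    have "\<exists>n \<beta>. n \<noteq> 0 \<and> (\<forall>z\<in>{x} \<times> {..<e}. n \<bullet> z \<le> \<beta>) \<and> (\<forall>z\<in>K. \<beta> \<le> n \<bullet> z)"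
    proof (rule separating_hyperplane_sets)
      show "{x} \<times> {..<e} \<noteq> {}" by (auto intro: exI[of _ "e - 1"])
      show "{x} \<times> {..<e} \<inter> K = {}" using emin by fastforce
    qed (use e in \<open>auto simp: K_def convex_Times\<close>)
    then show thesis using that by blast
  qed
  obtain w \<gamma> where n_eq: "n = (w, \<gamma>)" by (cases n)
  have up': "\<beta> \<le> w \<bullet> y + \<gamma> * t" if "(y, t) \<in> K" for y t
    using up[OF that] by (simp add: n_eq)
  have ray': "w \<bullet> x + \<gamma> * t \<le> \<beta>" if "t < e" for t
    using ray[of "(x, t)"] that by (simp add: n_eq)
  have upS: "\<beta> \<le> w \<bullet> q + \<gamma> * (norm q)\<^sup>2" if "q \<in> S" for q
    using that by (intro up') (simp add: K_def hull_inc)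
  \<comment> \<open>Comparing the ray at height \<open>e - 1\<close> with \<open>K\<close> at height
    \<open>e\<close> fixes the sign; equality, a vertical hyperplane, is not yet excluded.\<close>
  have \<gamma>0: "0 \<le> \<gamma>"
  proof -
    have "w \<bullet> x + \<gamma> * (e - 1) \<le> w \<bullet> x + \<gamma> * e" using ray'[of "e - 1"] up'[OF e] by simp
    then show ?thesis by (simp add: algebra_simps)
  qed
  have at: "w \<bullet> x + \<gamma> * e = \<beta>"
  proof (rule antisym)
    show "w \<bullet> x + \<gamma> * e \<le> \<beta>"
    proof (rule field_le_epsilon)
      fix \<epsilon> :: real assume \<epsilon>: "0 < \<epsilon>"
      \<comment> \<open>The denominator is \<open>\<gamma> + 1\<close> because
        \<open>\<gamma>\<close> may still be 0.\<close>
      have "w \<bullet> x + \<gamma> * (e - \<epsilon> / (\<gamma> + 1)) \<le> \<beta>" using \<epsilon> \<gamma>0 by (intro ray') simp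
      moreover have "\<gamma> * (\<epsilon> / (\<gamma> + 1)) \<le> \<epsilon>" using \<epsilon> \<gamma>0 by (simp add: field_simps)
      ultimately show "w \<bullet> x + \<gamma> * e \<le> \<beta> + \<epsilon>" by (simp add: algebra_simps)
    qed
  qed (rule up'[OF e])
  \<comment> \<open>A vertical hyperplane would project to one that supports the hull of
    \<open>S\<close> at its interior point \<open>x\<close>.\<close>
  have \<gamma>: "0 < \<gamma>"
  proof (rule ccontr)
    assume "\<not> 0 < \<gamma>"
    with \<gamma>0 have \<gamma>z: "\<gamma> = 0" by simp
    with n n_eq have w: "w \<noteq> 0" by (auto simp: zero_prod_def)
    have "convex hull S \<subseteq> {y. w \<bullet> y \<ge> \<beta>}"
      using upS \<gamma>z by (intro hull_minimal convex_halfspace_ge) auto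
    then have "interior (convex hull S) \<subseteq> {y. w \<bullet> y > \<beta>}"
      using interior_mono interior_halfspace_ge[OF w] by metis
    then show False using x at \<gamma>z by auto
  qed
  \<comment> \<open>Completing the square in
    \<open>w \<bullet> q + \<gamma> * (norm q)\<^sup>2\<close> gives this centre; \<open>T\<close>
    collects the contact points of the hyperplane.\<close>
  define c where "c = (-1 / (2 * \<gamma>)) *\<^sub>R w"
  define T where "T = {q\<in>S. w \<bullet> q + \<gamma> * (norm q)\<^sup>2 = \<beta>}"
  have dist: "\<gamma> * (norm (q - c))\<^sup>2 = w \<bullet> q + \<gamma> * (norm q)\<^sup>2 + \<gamma> * (norm c)\<^sup>2" for q
    unfolding norm_diff_square using \<gamma> by (simp add: c_def algebra_simps)
  obtain u where u: "\<forall>q\<in>S. 0 \<le> u q" "sum u S = 1" "(\<Sum>q\<in>S. u q *\<^sub>R q) = x"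
    "(\<Sum>q\<in>S. u q * (norm q)\<^sup>2) = e"
    using e mem by blast
  \<comment> \<open>The weights of the lowest lifted point over \<open>x\<close> average nonnegative
    gaps to 0, so they are carried by \<open>T\<close>.\<close>
  have "(\<Sum>q\<in>S. u q * (w \<bullet> q + \<gamma> * (norm q)\<^sup>2 - \<beta>)) =
      (w \<bullet> (\<Sum>q\<in>S. u q *\<^sub>R q) - \<beta>) + \<gamma> * (\<Sum>q\<in>S. u q * (norm q)\<^sup>2)"
    using affine_combination[OF u(2), of w "-\<beta>"]
    by (simp add: sum_distrib_left sum.distrib[symmetric] algebra_simps)
  then have "(\<Sum>q\<in>S. u q * (w \<bullet> q + \<gamma> * (norm q)\<^sup>2 - \<beta>)) = 0"
    using at u by simp
  moreover have "0 \<le> u q * (w \<bullet> q + \<gamma> * (norm q)\<^sup>2 - \<beta>)" if "q \<in> S" for q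
    using u(1) upS that by simp
  ultimately have "u q * (w \<bullet> q + \<gamma> * (norm q)\<^sup>2 - \<beta>) = 0" if "q \<in> S" for q
    using S that sum_nonneg_eq_0_iff[of S "\<lambda>q. u q * (w \<bullet> q + \<gamma> * (norm q)\<^sup>2 - \<beta>)"] by blast
  then have zero: "u q = 0" if "q \<in> S - T" for q
    using that by (auto simp: T_def)
  have TS: "T \<subseteq> S" "finite T" using S by (auto simp: T_def)
  have "sum u T = 1" "(\<Sum>q\<in>T. u q *\<^sub>R q) = x"
    unfolding u(2,3)[symmetric] using S TS zero by (intro sum.mono_neutral_left; auto)+
  then have xT: "x \<in> convex hull T"
    using u(1) TS by (auto simp: convex_hull_finite[OF TS(2)])
  then obtain p where p: "p \<in> T" by fastforce
  have "\<gamma> * (norm (p - c))\<^sup>2 \<le> \<gamma> * (norm (q - c))\<^sup>2" if "q \<in> S" for q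
    using upS[OF that] p unfolding dist by (simp add: T_def)
  then have 2: "norm (p - c) \<le> norm (q - c)" if "q \<in> S" for q
    using \<gamma> that by (simp add: power_mono_iff)
  have "\<gamma> * (norm (q - c))\<^sup>2 = \<gamma> * (norm (p - c))\<^sup>2" if "q \<in> T" for q
    using p that unfolding dist by (simp add: T_def)
  then have "norm (q - c) = norm (p - c)" if "q \<in> T" for q
    using \<gamma> that by (simp add: power_eq_iff_eq_base)
  with TS xT 2 that show thesis by blast
qed

lemma finite_delaunay:
  fixes S :: "'a::euclidean_space set"
  assumes "finite S"
  shows "finite (delaunay S)"
proof (rule finite_subset)
  show "delaunay S \<subseteq> (\<lambda>C. convex hull C) ` Pow S" by (auto simp: delaunay_def)
qed (use assms in simp)

text \<open>An interior point whose empty sphere carries \<open>d + 1\<close> points lies in a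
  Delaunay simplex. Otherwise it lies in the hull of at most \<open>d\<close> points, and these
  hulls form a null set. The uncovered part of the interior is open and null, hence empty; taking
  closures handles the boundary.\<close>

lemma Union_delaunay:
  fixes S :: "'a::euclidean_space set"
  assumes S: "generic S"
  shows "\<Union>(delaunay S) = convex hull S"
proof
  show "\<Union>(delaunay S) \<subseteq> convex hull S"
    by (auto simp: delaunay_def dest: hull_mono)
next
  let ?K = "convex hull S" and ?D = "\<Union>(delaunay S)"
  have fin: "finite S" using S by (rule generic_finite)
  have "closed E" if E: "E \<in> delaunay S" for E
  proof -
    obtain C where "C \<subseteq> S" "E = convex hull C" using E unfolding delaunay_def by blast
    then show ?thesis
      by (simp add: compact_imp_closed compact_convex_hull finite_imp_compact finite_subset[OF _ fin])
  qed
  then have clD: "closed ?D" using finite_delaunay[OF fin] by auto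
  define N where "N = (\<Union>T\<in>{T. T \<subseteq> S \<and> card T \<le> DIM('a)}. convex hull T)"
  have "negligible (convex hull T)" if "T \<subseteq> S" "card T \<le> DIM('a)" for T
    using empty_interior_convex_hull[of T] that finite_subset[OF that(1) fin]
    by (simp add: negligible_convex_interior)
  then have negN: "negligible N"
    unfolding N_def using fin by (intro negligible_Union) auto
  have "interior ?K - ?D \<subseteq> N"
  proof
    fix x assume x: "x \<in> interior ?K - ?D"
    then obtain T c r where T: "T \<subseteq> S" "x \<in> convex hull T" "\<And>p. p \<in> T \<Longrightarrow> norm (p - c) = r"
      "\<And>q. q \<in> S \<Longrightarrow> r \<le> norm (q - c)"
      using empty_sphere_around_interior_point[OF fin] by blast
    have "card T \<noteq> DIM('a) + 1"
    proof
      assume "card T = DIM('a) + 1"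
      moreover have "c \<in> (\<Inter>p\<in>T. voronoi_cell S p)"
        using T by (auto simp: voronoi_cell_def norm_minus_commute)
      ultimately have "convex hull T \<in> delaunay S" using T(1) by (auto simp: delaunay_def)
      with x T(2) show False by blast
    qed
    moreover have "card T \<le> DIM('a) + 1"
      using T by (intro generic_sphere_card[OF S, of T c r]) (auto simp: dist_norm norm_minus_commute)
    ultimately show "x \<in> N" using T by (auto simp: N_def)
  qed
  then have "negligible (interior ?K - ?D)" using negN negligible_subset by blast
  then have "interior ?K \<subseteq> ?D"
    using open_not_negligible[of "interior ?K - ?D"] clD by auto
  then have "closure (interior ?K) \<subseteq> ?D"
    using clD by (rule closure_minimal)
  moreover have "closure (interior ?K) = closure ?K"
    using S by (intro convex_closure_interior interior_convex_hull_affine_span)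
      (auto simp: generic_def)
  ultimately show "?K \<subseteq> ?D" using closure_subset by blast
qed

lemma vertices_convex_hull:
  "\<not> affine_dependent C \<Longrightarrow> vertices (convex hull C) = C"
  by (simp add: vertices_def extreme_point_of_convex_hull_affine_independent)

lemma triangulation_of_delaunay:
  fixes S :: "'a::euclidean_space set"
  assumes S: "generic S"
  shows "triangulation_of S (delaunay S)"
proof -
  have fin: "finite S" using S by (rule generic_finite)
  have simp: "int DIM('a) simplex E" if E: "E \<in> delaunay S" for E
  proof -
    obtain C a b where "E = convex hull C" "\<not> affine_dependent C" "card C = DIM('a) + 1"
      "lower_facet S C a b"
      using delaunay_lower_facet[OF S E] .
    then show ?thesis
      using simplex_convex_hull[of C "int DIM('a)"] by simp
  qed
  have face: "E \<inter> E' face_of E" if E: "E \<in> delaunay S" "E' \<in> delaunay S" for E E'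
  proof -
    obtain C a b where C: "E = convex hull C" "\<not> affine_dependent C" "card C = DIM('a) + 1"
      "lower_facet S C a b"
      using delaunay_lower_facet[OF S E(1)] .
    obtain C' a' b' where C': "E' = convex hull C'" "\<not> affine_dependent C'"
      "card C' = DIM('a) + 1" "lower_facet S C' a' b'"
      using delaunay_lower_facet[OF S E(2)] .
    show ?thesis
      using convex_hull_Int_lower_facets[OF fin C(4) C'(4)] C C'
      by (auto simp: face_of_convex_hull_affine_independent)
  qed
  have "(\<Union>E\<in>delaunay S. vertices E) = S"
  proof
    show "(\<Union>E\<in>delaunay S. vertices E) \<subseteq> S"
    proof safe
      fix E x assume E: "E \<in> delaunay S" "x \<in> vertices E"
      obtain C a b where "E = convex hull C" "\<not> affine_dependent C" "card C = DIM('a) + 1"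
        "lower_facet S C a b"
        using delaunay_lower_facet[OF S E(1)] .
      with E(2) show "x \<in> S" by (auto simp: vertices_convex_hull lower_facet_def)
    qed
  next
    show "S \<subseteq> (\<Union>E\<in>delaunay S. vertices E)"
    proof
      fix p assume p: "p \<in> S"
      then have "p \<in> \<Union>(delaunay S)" by (simp add: Union_delaunay[OF S] hull_inc)
      then obtain E where E: "E \<in> delaunay S" "p \<in> E" by blast
      obtain C a b where C: "E = convex hull C" "\<not> affine_dependent C" "card C = DIM('a) + 1"
        "lower_facet S C a b"
        using delaunay_lower_facet[OF S E(1)] .
      have "p \<in> vertices E"
        using lower_facet_contains_vertex[OF fin C(4) p] E(2) C by (simp add: vertices_convex_hull)
      with E(1) show "p \<in> (\<Union>E\<in>delaunay S. vertices E)" by blast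
    qed
  qed
  with simp face Union_delaunay[OF S] finite_delaunay[OF fin] show ?thesis
    unfolding triangulation_of_def triangulation_def by blast
qed

section \<open>Integrals of affine functions over simplices\<close>

lemma integrable_on_compact_continuous:
  fixes f :: "'a::euclidean_space \<Rightarrow> real"
  assumes "compact K" "continuous_on UNIV f"
  shows "f integrable_on K"
proof -
  have "set_integrable lborel K f"
    unfolding set_integrable_def
    using assms continuous_on_subset by (intro borel_integrable_compact) auto
  then show ?thesis by (rule set_borel_integral_eq_integral)
qed

lemma has_integral_homothety:
  fixes f :: "'a::euclidean_space \<Rightarrow> real"
  assumes K: "bounded K" and f: "(f has_integral i) ((\<lambda>x. r *\<^sub>R x + c) ` K)" and r: "0 < r"
  shows "((\<lambda>x. f (r *\<^sub>R x + c)) has_integral (i / r ^ DIM('a))) K"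
proof -
  let ?g = "\<lambda>x. r *\<^sub>R x + c"
  have "bounded (?g ` K)"
    using K bounded_scaling[of K r] bounded_translation[of "(*\<^sub>R) r ` K" c]
    by (simp add: image_image add.commute)
  then obtain u v where uv: "?g ` K \<subseteq> cbox u v"
    using bounded_subset_cbox_symmetric by blast
  \<comment> \<open>Extension by zero moves the integral to a box, where the affine change of
    variables applies.\<close>
  let ?h = "\<lambda>y. if y \<in> ?g ` K then f y else 0"
  have "(?h has_integral i) (cbox u v)" using f uv by simp
  then have "((\<lambda>x. ?h (?g x)) has_integral (i /\<^sub>R r ^ DIM('a)))
      (cbox ((u - c) /\<^sub>R r) ((v - c) /\<^sub>R r))" (is "(_ has_integral _) ?B")
    using has_integral_affinity'[of ?h i u v r c] r by simp
  moreover have "?g x \<in> ?g ` K \<longleftrightarrow> x \<in> K" for x using r by auto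
  ultimately have *: "((\<lambda>x. if x \<in> K then f (?g x) else 0) has_integral (i /\<^sub>R r ^ DIM('a))) ?B"
    by (simp only:)
  have "K \<subseteq> ?B"
  proof
    fix x assume "x \<in> K"
    then have "?g x \<in> cbox u v" using uv by blast
    then show "x \<in> ?B"
      using r by (auto simp: mem_box inner_diff_left inner_add_left field_simps)
  qed
  with * show ?thesis by (simp add: divide_inverse mult.commute)
qed

text \<open>Dividing by \<open>1 - r\<close> leaves geometric sums with \<open>d + 1\<close> and
  \<open>d\<close> terms, which tend to their numbers of terms as \<open>r\<close> tends to 1 from
  the left.\<close>

lemma geometric_squeeze:
  fixes M v :: real
  assumes "\<And>r. 0 < r \<Longrightarrow> r < 1 \<Longrightarrow> (1 - r ^ Suc d) * M \<le> (1 - r ^ d) * v"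
  shows "real (d + 1) * M \<le> real d * v"
proof -
  have "(\<Sum>i<Suc d. r ^ i) * M \<le> (\<Sum>i<d. r ^ i) * v" if "0 < r" "r < 1" for r :: real
  proof -
    have "(1 - r) * ((\<Sum>i<Suc d. r ^ i) * M) \<le> (1 - r) * ((\<Sum>i<d. r ^ i) * v)"
      using assms[OF that] unfolding one_diff_power_eq by (simp only: mult.assoc)
    then show ?thesis using that by (simp only: mult_le_cancel_left_pos diff_gt_0_iff_gt)
  qed
  then have ev: "eventually (\<lambda>r. (\<Sum>i<Suc d. r ^ i) * M \<le> (\<Sum>i<d. r ^ i) * v) (at_left (1::real))"
    unfolding eventually_at_left_field by (intro exI[of _ 0]) auto
  have lim: "((\<lambda>r. (\<Sum>i<k. r ^ i) * c) \<longlongrightarrow> (\<Sum>i<k. 1 ^ i) * c) (at_left (1::real))" for k c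
    by (intro tendsto_intros)
  have "(\<Sum>i<Suc d. (1::real) ^ i) * M \<le> (\<Sum>i<d. 1 ^ i) * v"
    using ev by (intro tendsto_le[OF _ lim lim]) auto
  then show ?thesis by (simp add: algebra_simps)
qed

text \<open>The integrand is compared on \<open>K\<close> and on its homothetic copy \<open>p + r(K - p) \<subseteq> K\<close>, where 1
  minus the integrand scales by \<open>r\<close>; letting \<open>r\<close> tend to 1 avoids an iterated integral.\<close>

lemma integral_affine_cone_ge:
  fixes K :: "'a::euclidean_space set"
  assumes K: "compact K" "convex K" "p \<in> K" and p: "a \<bullet> p + b = 1"
    and nonneg: "\<And>x. x \<in> K \<Longrightarrow> 0 \<le> a \<bullet> x + b"
  shows "measure lebesgue K \<le> (DIM('a) + 1) * integral K (\<lambda>x. a \<bullet> x + b)"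
proof -
  define \<mu> where "\<mu> x = 1 - (a \<bullet> x + b)" for x
  define v where "v = measure lebesgue K"
  define M where "M = integral K \<mu>"
  have cont: "continuous_on UNIV \<mu>" "continuous_on UNIV (\<lambda>x. 1 - \<mu> x)"
    unfolding \<mu>_def by (intro continuous_intros)+
  have v: "v = integral K (\<lambda>x. 1)"
    using lmeasure_integral[OF lmeasurable_compact[OF K(1)]] by (simp add: v_def)
  have int1: "(\<lambda>x. 1::real) integrable_on L" if "compact L" for L :: "'a set"
    using that by (intro integrable_on_compact_continuous) auto
  have "(1 - r ^ Suc DIM('a)) * M \<le> (1 - r ^ DIM('a)) * v" if r: "0 < r" "r < 1" for r
  proof -
    define c where "c = (1 - r) *\<^sub>R p"
    let ?L = "(\<lambda>x. r *\<^sub>R x + c) ` K"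
    have cL: "compact ?L"
      using K(1) by (intro compact_continuous_image continuous_intros) auto
    have LK: "?L \<subseteq> K"
      using convexD_alt[OF K(2,3)] r by (auto simp: c_def add.commute)
    have bK: "bounded K" using K(1) by (rule compact_imp_bounded)
    have scale: "integral ?L f = r ^ DIM('a) * integral K (\<lambda>x. f (r *\<^sub>R x + c))"
      if "continuous_on UNIV f" for f :: "'a \<Rightarrow> real"
    proof -
      have "(f has_integral integral ?L f) ?L"
        using integrable_on_compact_continuous[OF cL that] by (simp add: integrable_integral)
      from integral_unique[OF has_integral_homothety[OF bK this r(1)]] r show ?thesis
        by (simp add: field_simps)
    qed
    \<comment> \<open>\<open>\<mu>\<close> is affine and vanishes at \<open>p\<close>, the centre of
      the homothety.\<close>
    have \<mu>g: "\<mu> (r *\<^sub>R x + c) = r * \<mu> x" for x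
    proof -
      have b: "b = 1 - a \<bullet> p" using p by simp
      show ?thesis unfolding \<mu>_def c_def b by (simp add: inner_add_right algebra_simps)
    qed
    have "integral ?L (\<lambda>x. 1 - \<mu> x) \<le> integral K (\<lambda>x. 1 - \<mu> x)"
      using LK cont nonneg K(1) cL
      by (intro integral_subset_le integrable_on_compact_continuous) (auto simp: \<mu>_def)
    moreover have "integral L (\<lambda>x. 1 - \<mu> x) = integral L (\<lambda>x. 1) - integral L \<mu>"
      if "compact L" for L
      using that cont by (intro integral_diff int1 integrable_on_compact_continuous)
    moreover have "integral ?L (\<lambda>x. 1) = r ^ DIM('a) * v"
      unfolding v by (rule scale) auto
    moreover have "integral ?L \<mu> = r ^ DIM('a) * (r * M)"
      using scale[OF cont(1)] by (simp add: \<mu>g M_def)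
    ultimately have "r ^ DIM('a) * v - r ^ DIM('a) * (r * M) \<le> v - M"
      using K(1) cL by (simp add: v M_def)
    then show ?thesis by (simp add: algebra_simps)
  qed
  from geometric_squeeze[OF this]
  have bound: "real (DIM('a) + 1) * M \<le> DIM('a) * v" .
  have "integral K (\<lambda>x. a \<bullet> x + b) = v - M"
  proof -
    have "integral K (\<lambda>x. 1 - \<mu> x) = integral K (\<lambda>x. 1) - integral K \<mu>"
      using K(1) cont by (intro integral_diff int1 integrable_on_compact_continuous)
    then show ?thesis by (simp add: \<mu>_def v M_def)
  qed
  then have M: "M = v - integral K (\<lambda>x. a \<bullet> x + b)" by linarith
  show ?thesis using bound unfolding v_def[symmetric] M by (simp add: ring_distribs)
qed

text \<open>By linearity only the barycentric coordinates matter. The cone estimate bounds each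
  integral \<open>I p\<close> from below by \<open>v / (d + 1)\<close>; since the
  \<open>d + 1\<close> integrals add up to \<open>v\<close>, all these bounds are
  equalities.\<close>

lemma integral_affine_simplex:
  fixes C :: "'a::euclidean_space set"
  assumes C: "\<not> affine_dependent C" "card C = DIM('a) + 1"
  shows "(DIM('a) + 1) * integral (convex hull C) (\<lambda>x. a \<bullet> x + b) =
    (\<Sum>q\<in>C. a \<bullet> q + b) * measure lebesgue (convex hull C)"
proof -
  let ?K = "convex hull C" and ?d = "real (DIM('a) + 1)"
  define v where "v = measure lebesgue ?K"
  have fin: "finite C" using C(1) by (rule aff_independent_finite)
  have span: "affine hull C = UNIV" using C by (intro affine_independent_span_gt) auto
  have cK: "compact ?K" using fin by (intro compact_convex_hull finite_imp_compact)
  have "\<exists>\<alpha> \<beta>. \<forall>q\<in>C. \<alpha> \<bullet> q + \<beta> = (if q = p then 1 else 0)" for p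
  proof -
    obtain \<alpha> \<beta> where "\<And>q. q \<in> C \<Longrightarrow> \<alpha> \<bullet> q + \<beta> = (if q = p then 1 else 0)"
      using affine_extension_exists[OF C(1), of "\<lambda>q. if q = p then 1 else 0"] by blast
    then show ?thesis by blast
  qed
  then obtain \<alpha> \<beta> where bary: "\<And>p q. q \<in> C \<Longrightarrow> \<alpha> p \<bullet> q + \<beta> p = (if q = p then 1 else 0)"
    by metis
  have int: "(\<lambda>x. w \<bullet> x + \<gamma>) integrable_on ?K" for w :: 'a and \<gamma>
    by (intro integrable_on_compact_continuous[OF cK] continuous_intros)
  define I where "I p = integral ?K (\<lambda>x. \<alpha> p \<bullet> x + \<beta> p)" for p
  have expand: "w \<bullet> x + \<gamma> = (\<Sum>p\<in>C. (w \<bullet> p + \<gamma>) * (\<alpha> p \<bullet> x + \<beta> p))" for w x \<gamma>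
  proof -
    have "w \<bullet> x + \<gamma> = (\<Sum>p\<in>C. (w \<bullet> p + \<gamma>) *\<^sub>R \<alpha> p) \<bullet> x + (\<Sum>p\<in>C. (w \<bullet> p + \<gamma>) * \<beta> p)"
    proof (rule affine_functions_eqI[OF span])
      fix q assume q: "q \<in> C"
      have "(\<Sum>p\<in>C. (w \<bullet> p + \<gamma>) *\<^sub>R \<alpha> p) \<bullet> q + (\<Sum>p\<in>C. (w \<bullet> p + \<gamma>) * \<beta> p) =
          (\<Sum>p\<in>C. (w \<bullet> p + \<gamma>) * (\<alpha> p \<bullet> q + \<beta> p))"
        by (simp add: inner_sum_left sum.distrib[symmetric] algebra_simps)
      also have "\<dots> = (\<Sum>p\<in>C. (w \<bullet> p + \<gamma>) * (if q = p then 1 else 0))"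
        using bary[OF q] by simp
      also have "\<dots> = w \<bullet> q + \<gamma>" using fin q by (simp add: mult_delta_right)
      finally show "w \<bullet> q + \<gamma> =
        (\<Sum>p\<in>C. (w \<bullet> p + \<gamma>) *\<^sub>R \<alpha> p) \<bullet> q + (\<Sum>p\<in>C. (w \<bullet> p + \<gamma>) * \<beta> p)" by simp
    qed
    then show ?thesis
      by (simp add: inner_sum_left sum.distrib[symmetric] algebra_simps)
  qed
  have integral_expand: "integral ?K (\<lambda>x. w \<bullet> x + \<gamma>) = (\<Sum>p\<in>C. (w \<bullet> p + \<gamma>) * I p)" for w \<gamma>
  proof -
    have "integral ?K (\<lambda>x. w \<bullet> x + \<gamma>) =
        integral ?K (\<lambda>x. \<Sum>p\<in>C. (w \<bullet> p + \<gamma>) * (\<alpha> p \<bullet> x + \<beta> p))"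
      by (subst expand) (rule refl)
    also have "\<dots> = (\<Sum>p\<in>C. integral ?K (\<lambda>x. (w \<bullet> p + \<gamma>) * (\<alpha> p \<bullet> x + \<beta> p)))"
      using fin int by (intro integral_sum integrable_on_mult_right) auto
    finally show ?thesis by (simp add: I_def)
  qed
  have ge: "v \<le> ?d * I p" if p: "p \<in> C" for p
    unfolding v_def I_def
  proof (rule integral_affine_cone_ge[OF cK convex_convex_hull])
    show "p \<in> ?K" using p by (rule hull_inc)
    show "\<alpha> p \<bullet> p + \<beta> p = 1" using bary[OF p] by simp
    have "?K \<subseteq> {x. \<alpha> p \<bullet> x \<ge> - \<beta> p}"
    proof (intro hull_minimal convex_halfspace_ge subsetI CollectI)
      fix q assume "q \<in> C"
      then have "0 \<le> \<alpha> p \<bullet> q + \<beta> p" by (simp add: bary)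
      then show "- \<beta> p \<le> \<alpha> p \<bullet> q" by simp
    qed
    then show "0 \<le> \<alpha> p \<bullet> x + \<beta> p" if "x \<in> ?K" for x using that by force
  qed
  \<comment> \<open>The constant function 1, that is \<open>w = 0\<close> and
    \<open>\<gamma> = 1\<close>, expresses that the barycentric coordinates sum to 1.\<close>
  have "v = (\<Sum>p\<in>C. I p)"
    using integral_expand[of 0 1] lmeasure_integral[OF lmeasurable_compact[OF cK]]
    by (simp add: v_def)
  then have "(\<Sum>p\<in>C. ?d * I p - v) = 0"
    using C(2) by (simp add: sum_subtractf sum_distrib_left[symmetric])
  then have eq: "?d * I p = v" if "p \<in> C" for p
    using sum_nonneg_eq_0_iff[OF fin, of "\<lambda>p. ?d * I p - v"] ge that by fastforce
  have "?d * (\<Sum>p\<in>C. (a \<bullet> p + b) * I p) = (\<Sum>p\<in>C. (a \<bullet> p + b) * (?d * I p))"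
    unfolding sum_distrib_left by (intro sum.cong refl mult.left_commute)
  also have "\<dots> = (\<Sum>p\<in>C. (a \<bullet> p + b) * v)"
    using eq by (intro sum.cong) (simp_all only:)
  finally have "?d * (\<Sum>p\<in>C. (a \<bullet> p + b) * I p) = (\<Sum>p\<in>C. (a \<bullet> p + b) * v)" .
  then show ?thesis by (simp add: integral_expand v_def sum_distrib_right)
qed

section \<open>Comparing triangulations\<close>

lemma triangulation_of_simplex:
  fixes S :: "'a::euclidean_space set"
  assumes "triangulation_of S t" "\<Delta> \<in> t"
  shows "\<Delta> = convex hull (vertices \<Delta>)" "\<not> affine_dependent (vertices \<Delta>)"
    "card (vertices \<Delta>) = DIM('a) + 1" "vertices \<Delta> \<subseteq> S"
proof -
  obtain C where C: "\<not> affine_dependent C" "int (card C) = int DIM('a) + 1" "\<Delta> = convex hull C"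
    using assms unfolding triangulation_of_def simplex_def by blast
  then have "vertices \<Delta> = C" by (simp add: vertices_convex_hull)
  with C show "\<Delta> = convex hull (vertices \<Delta>)" "\<not> affine_dependent (vertices \<Delta>)"
    "card (vertices \<Delta>) = DIM('a) + 1" by auto
  show "vertices \<Delta> \<subseteq> S"
    using assms unfolding triangulation_of_def by blast
qed

lemma triangulation_of_compact_convex:
  fixes S :: "'a::euclidean_space set"
  assumes "triangulation_of S t" "\<Delta> \<in> t"
  shows "compact \<Delta>" "convex \<Delta>"
proof -
  note \<Delta> = triangulation_of_simplex[OF assms]
  have "finite (vertices \<Delta>)" using \<Delta>(2) by (rule aff_independent_finite)
  then have "compact (convex hull (vertices \<Delta>))"
    by (intro compact_convex_hull finite_imp_compact)
  then show "compact \<Delta>" using \<Delta>(1) by simp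
  show "convex \<Delta>" by (subst \<Delta>(1)) (rule convex_convex_hull)
qed

lemma triangulation_of_finite: "triangulation_of S t \<Longrightarrow> finite t"
  by (simp add: triangulation_of_def triangulation_def)

lemma triangulation_of_overlap_negligible:
  fixes S :: "'a::euclidean_space set"
  assumes t: "triangulation_of S t" and "\<Delta> \<in> t" "\<Delta>' \<in> t" "\<Delta> \<noteq> \<Delta>'"
  shows "negligible (\<Delta> \<inter> \<Delta>')"
proof (rule negligible_Int_faces)
  have face: "T \<inter> T' face_of T" if "T \<in> t" "T' \<in> t" for T T'
    using t that unfolding triangulation_of_def triangulation_def by blast
  show "\<Delta> \<inter> \<Delta>' face_of \<Delta>" using face assms by blast
  show "\<Delta> \<inter> \<Delta>' face_of \<Delta>'" using face[OF assms(3,2)] by (simp add: Int_commute)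
qed (use assms triangulation_of_compact_convex(2)[OF t] in auto)

text \<open>A function on the whole space, so that interpolants of different simplices can be
  compared anywhere. The vertices of a \<open>d\<close>-simplex span the space affinely, hence the
  choice is unique there.\<close>

definition paraboloid_interp :: "'a::euclidean_space set \<Rightarrow> 'a \<Rightarrow> real" where
  "paraboloid_interp \<Delta> =
    (SOME f. \<exists>a b. f = (\<lambda>x. a \<bullet> x + b) \<and> (\<forall>q\<in>vertices \<Delta>. a \<bullet> q + b = (norm q)\<^sup>2))"

lemma paraboloid_interp_affine:
  assumes "\<not> affine_dependent (vertices \<Delta>)"
  obtains a b where "paraboloid_interp \<Delta> = (\<lambda>x. a \<bullet> x + b)"
    "\<And>q. q \<in> vertices \<Delta> \<Longrightarrow> a \<bullet> q + b = (norm q)\<^sup>2"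
proof -
  obtain a b where "\<And>q. q \<in> vertices \<Delta> \<Longrightarrow> a \<bullet> q + b = (norm q)\<^sup>2"
    using affine_extension_exists[OF assms, of "\<lambda>q. (norm q)\<^sup>2"] by blast
  then have "\<exists>f a b. f = (\<lambda>x. a \<bullet> x + b) \<and> (\<forall>q\<in>vertices \<Delta>. a \<bullet> q + b = (norm q)\<^sup>2)"
    by blast
  from someI_ex[OF this, folded paraboloid_interp_def] that show thesis by blast
qed

lemma paraboloid_interp_convex_combination:
  assumes "\<not> affine_dependent (vertices \<Delta>)" "sum u (vertices \<Delta>) = 1"
  shows "paraboloid_interp \<Delta> (\<Sum>q\<in>vertices \<Delta>. u q *\<^sub>R q) = (\<Sum>q\<in>vertices \<Delta>. u q * (norm q)\<^sup>2)"
proof -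
  obtain a b where ab: "paraboloid_interp \<Delta> = (\<lambda>x. a \<bullet> x + b)"
    "\<And>q. q \<in> vertices \<Delta> \<Longrightarrow> a \<bullet> q + b = (norm q)\<^sup>2"
    using paraboloid_interp_affine[OF assms(1)] by blast
  show ?thesis unfolding ab(1) affine_combination[OF assms(2)] using ab(2) by simp
qed

lemma continuous_paraboloid_interp:
  assumes "\<not> affine_dependent (vertices \<Delta>)"
  shows "continuous_on A (paraboloid_interp \<Delta>)"
proof -
  obtain a b where "paraboloid_interp \<Delta> = (\<lambda>x. a \<bullet> x + b)"
    using paraboloid_interp_affine[OF assms] by blast
  then show ?thesis by (simp add: continuous_intros)
qed

lemma V_eq_integral:
  fixes S :: "'a::euclidean_space set"
  assumes t: "triangulation_of S t"
  shows "V t = (DIM('a) + 1) * (\<Sum>\<Delta>\<in>t. integral \<Delta> (paraboloid_interp \<Delta>))"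
  unfolding V_def sum_distrib_left
proof (rule sum.cong[OF refl])
  fix \<Delta> assume "\<Delta> \<in> t"
  note \<Delta> = triangulation_of_simplex[OF t this]
  obtain a b where ab: "paraboloid_interp \<Delta> = (\<lambda>x. a \<bullet> x + b)"
    "\<And>q. q \<in> vertices \<Delta> \<Longrightarrow> a \<bullet> q + b = (norm q)\<^sup>2"
    using paraboloid_interp_affine[OF \<Delta>(2)] by blast
  show "(\<Sum>x\<in>vertices \<Delta>. (norm x)\<^sup>2) * measure lebesgue \<Delta> =
      (DIM('a) + 1) * integral \<Delta> (paraboloid_interp \<Delta>)"
    using integral_affine_simplex[OF \<Delta>(2,3), of a b, folded \<Delta>(1)] ab by simp
qed

lemma paraboloid_interp_delaunay:
  fixes S :: "'a::euclidean_space set"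
  assumes S: "generic S" and E: "E \<in> delaunay S"
  obtains a b where "paraboloid_interp E = (\<lambda>x. a \<bullet> x + b)" "lower_facet S (vertices E) a b"
proof -
  obtain C a b where C: "E = convex hull C" "\<not> affine_dependent C" "card C = DIM('a) + 1"
    "lower_facet S C a b"
    using delaunay_lower_facet[OF S E] .
  have vE: "vertices E = C" using C by (simp add: vertices_convex_hull)
  obtain a' b' where ab': "paraboloid_interp E = (\<lambda>x. a' \<bullet> x + b')"
    "\<And>q. q \<in> C \<Longrightarrow> a' \<bullet> q + b' = (norm q)\<^sup>2"
    using paraboloid_interp_affine[of E] C(2) unfolding vE by blast
  have "affine hull C = UNIV" using C by (intro affine_independent_span_gt) auto
  moreover have "a' \<bullet> q + b' = a \<bullet> q + b" if "q \<in> C" for q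
    using C(4) ab'(2)[OF that] that by (simp add: lower_facet_def)
  ultimately have "a' \<bullet> x + b' = a \<bullet> x + b" for x
    by (rule affine_functions_eqI)
  then have "paraboloid_interp E = (\<lambda>x. a \<bullet> x + b)"
    unfolding ab'(1) by (rule ext)
  then show thesis using C(4) unfolding vE[symmetric] by (rule that)
qed

text \<open>\<open>x\<close> need not lie in \<open>E\<close>: the function of \<open>E\<close>
  supports the lifted points from below at all vertices of \<open>\<Delta>\<close>, and both
  functions are affine.\<close>

lemma paraboloid_interp_delaunay_le:
  fixes S :: "'a::euclidean_space set"
  assumes S: "generic S" and t: "triangulation_of S t" and \<Delta>: "\<Delta> \<in> t"
    and E: "E \<in> delaunay S" and x: "x \<in> \<Delta>"
  shows "paraboloid_interp E x \<le> paraboloid_interp \<Delta> x"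
proof -
  note \<Delta> = triangulation_of_simplex[OF t \<Delta>]
  have fin: "finite (vertices \<Delta>)" using \<Delta>(2) by (rule aff_independent_finite)
  obtain a b where ab: "paraboloid_interp E = (\<lambda>x. a \<bullet> x + b)" "lower_facet S (vertices E) a b"
    using paraboloid_interp_delaunay[OF S E] by blast
  have "x \<in> convex hull (vertices \<Delta>)" using x \<Delta>(1) by simp
  then obtain u where u: "\<forall>q\<in>vertices \<Delta>. 0 \<le> u q" "sum u (vertices \<Delta>) = 1"
    "(\<Sum>q\<in>vertices \<Delta>. u q *\<^sub>R q) = x"
    by (auto simp: convex_hull_finite[OF fin])
  show ?thesis
    using lower_facet_combination_le[OF ab(2) \<Delta>(4), of u] u
      paraboloid_interp_convex_combination[OF \<Delta>(2) u(2)] by (simp add: ab(1))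
qed

text \<open>Equal numbers of vertices force \<open>\<Delta>\<close> to have a vertex that
  \<open>E\<close> lacks. At an interior point its weight is positive, whereas equality of the
  interpolants would make it 0.\<close>

lemma paraboloid_interp_delaunay_less:
  fixes S :: "'a::euclidean_space set"
  assumes S: "generic S" and t: "triangulation_of S t" and \<Delta>: "\<Delta> \<in> t"
    and E: "E \<in> delaunay S" and x: "x \<in> interior \<Delta>" and ne: "\<Delta> \<noteq> E"
  shows "paraboloid_interp E x < paraboloid_interp \<Delta> x"
proof -
  have le: "paraboloid_interp E x \<le> paraboloid_interp \<Delta> x"
    using paraboloid_interp_delaunay_le[OF S t \<Delta> E] x interior_subset by blast
  note \<Delta> = triangulation_of_simplex[OF t \<Delta>]
  note E' = triangulation_of_simplex[OF triangulation_of_delaunay[OF S] E]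
  have fin: "finite (vertices \<Delta>)" using \<Delta>(2) by (rule aff_independent_finite)
  obtain a b where ab: "paraboloid_interp E = (\<lambda>x. a \<bullet> x + b)" "lower_facet S (vertices E) a b"
    using paraboloid_interp_delaunay[OF S E] by blast
  have "vertices \<Delta> \<noteq> vertices E" using ne \<Delta>(1) E'(1) by metis
  moreover have "finite (vertices E)" using E'(2) by (rule aff_independent_finite)
  ultimately have "\<not> vertices \<Delta> \<subseteq> vertices E"
    using \<Delta>(3) E'(3) card_subset_eq by metis
  then obtain q where q: "q \<in> vertices \<Delta>" "q \<notin> vertices E" by blast
  have "x \<in> interior (convex hull (vertices \<Delta>))" using x \<Delta>(1) by simp
  then obtain u where u: "\<forall>q\<in>vertices \<Delta>. 0 < u q" "sum u (vertices \<Delta>) = 1"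
    "(\<Sum>q\<in>vertices \<Delta>. u q *\<^sub>R q) = x"
    using \<Delta>(3) by (auto simp: interior_convex_hull_explicit_minimal[OF \<Delta>(2)])
  have "paraboloid_interp E x \<noteq> paraboloid_interp \<Delta> x"
  proof
    assume "paraboloid_interp E x = paraboloid_interp \<Delta> x"
    then have "a \<bullet> (\<Sum>q\<in>vertices \<Delta>. u q *\<^sub>R q) + b = (\<Sum>q\<in>vertices \<Delta>. u q * (norm q)\<^sup>2)"
      using paraboloid_interp_convex_combination[OF \<Delta>(2) u(2)] u(3) by (simp add: ab(1))
    moreover have "0 \<le> u q" if "q \<in> vertices \<Delta>" for q using u(1) that by force
    ultimately have "u q = 0"
      using lower_facet_combination_eq[OF ab(2) \<Delta>(4) fin _ u(2) _ q] by blast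
    with u(1) q(1) show False by force
  qed
  with le show ?thesis by simp
qed

section \<open>Overlaps of two triangulations\<close>

lemma triangulation_of_refine:
  fixes S :: "'a::euclidean_space set"
  assumes t: "triangulation_of S t" "\<Delta> \<in> t" and t': "triangulation_of S t'"
  shows "\<Delta> = (\<Union>E\<in>t'. \<Delta> \<inter> E)"
proof -
  have "\<Union>t = \<Union>t'" using t(1) t' by (simp add: triangulation_of_def)
  then have "\<Delta> \<subseteq> \<Union>t'" using t(2) by blast
  then show ?thesis by blast
qed

lemma integral_refine:
  fixes S :: "'a::euclidean_space set" and f :: "'a \<Rightarrow> real"
  assumes t: "triangulation_of S t" "\<Delta> \<in> t" and t': "triangulation_of S t'"
    and f: "continuous_on UNIV f"
  shows "integral \<Delta> f = (\<Sum>E\<in>t'. integral (\<Delta> \<inter> E) f)"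
proof -
  have "(f has_integral (\<Sum>E\<in>t'. integral (\<Delta> \<inter> E) f)) (\<Union>E\<in>t'. \<Delta> \<inter> E)"
  proof (rule has_integral_UN)
    show "finite t'" using t' by (rule triangulation_of_finite)
    show "(f has_integral integral (\<Delta> \<inter> E) f) (\<Delta> \<inter> E)" if "E \<in> t'" for E
      using triangulation_of_compact_convex(1)[OF t] triangulation_of_compact_convex(1)[OF t' that]
      by (intro integrable_integral integrable_on_compact_continuous f compact_Int)
    show "pairwise (\<lambda>E E'. negligible ((\<Delta> \<inter> E) \<inter> (\<Delta> \<inter> E'))) t'"
      using triangulation_of_overlap_negligible[OF t']
      by (auto simp: pairwise_def intro: negligible_subset[of "E \<inter> E'" for E E'])
  qed
  then show ?thesis
    using triangulation_of_refine[OF t t'] by (metis integral_unique)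
qed

text \<open>Finitely many convex pieces with empty interior are null and cannot cover a simplex with
  nonempty interior.\<close>

lemma triangulation_of_overlap_exists:
  fixes S :: "'a::euclidean_space set"
  assumes t: "triangulation_of S t" "\<Delta> \<in> t" and t': "triangulation_of S t'"
  obtains E where "E \<in> t'" "interior (\<Delta> \<inter> E) \<noteq> {}"
proof (rule ccontr)
  assume "\<not> thesis"
  with that have empty: "interior (\<Delta> \<inter> E) = {}" if "E \<in> t'" for E
    using that by blast
  note \<Delta> = triangulation_of_simplex[OF t]
  have "negligible (\<Delta> \<inter> E)" if "E \<in> t'" for E
    using empty[OF that] triangulation_of_compact_convex(2)[OF t]
      triangulation_of_compact_convex(2)[OF t' that]
    by (simp add: negligible_convex_interior convex_Int del: interior_Int)
  then have "negligible (\<Union>E\<in>t'. \<Delta> \<inter> E)"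
    using triangulation_of_finite[OF t'] by (intro negligible_Union) auto
  then have "interior \<Delta> = {}"
    using triangulation_of_refine[OF t t'] triangulation_of_compact_convex(2)[OF t]
    by (simp add: negligible_convex_interior)
  moreover have "interior (convex hull (vertices \<Delta>)) \<noteq> {}"
    using \<Delta>(2,3) by (intro interior_convex_hull_affine_span affine_independent_span_gt) auto
  ultimately show False using \<Delta>(1) by simp
qed

lemma integral_pos_if_interior:
  fixes f :: "'a::euclidean_space \<Rightarrow> real"
  assumes K: "compact K" "interior K \<noteq> {}" and f: "continuous_on UNIV f"
    and nonneg: "\<And>x. x \<in> K \<Longrightarrow> 0 \<le> f x" and pos: "\<And>x. x \<in> interior K \<Longrightarrow> 0 < f x"
  shows "0 < integral K f"
proof (rule ccontr)
  assume neg: "\<not> 0 < integral K f"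
  obtain x where x: "x \<in> interior K" using K by blast
  then obtain u v where uv: "cbox u v \<subseteq> interior K" "x \<in> box u v"
    using open_contains_cbox[OF open_interior] by metis
  have sub: "cbox u v \<subseteq> K" using uv interior_subset by blast
  have int: "f integrable_on K" "f integrable_on cbox u v"
    using K f by (auto intro!: integrable_on_compact_continuous)
  have "integral (cbox u v) f \<le> integral K f"
    using sub int nonneg by (intro integral_subset_le) auto
  moreover have "0 \<le> integral (cbox u v) f"
    using int sub nonneg by (intro integral_nonneg) auto
  ultimately have "(f has_integral 0) (cbox u v)"
    using int neg by (metis antisym integrable_integral not_le order_trans)
  moreover have "x \<in> cbox u v" using uv box_subset_cbox by blast
  moreover have "0 \<le> f y" if "y \<in> box u v" for y
    using that sub nonneg box_subset_cbox by blast
  ultimately have "f x = 0"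
    using has_integral_0_cbox_imp_0[of u v f x] f uv(2) continuous_on_subset by blast
  with pos[OF x] show False by simp
qed

text \<open>The overlaps refine both triangulations at once, so after exchanging the order of
  summation the two integrals are compared piece by piece.\<close>

lemma V_diff_delaunay:
  fixes S :: "'a::euclidean_space set"
  assumes S: "generic S" and t: "triangulation_of S t"
  shows "V t - V (delaunay S) = (DIM('a) + 1) * (\<Sum>\<Delta>\<in>t. \<Sum>E\<in>delaunay S.
    integral (\<Delta> \<inter> E) (\<lambda>x. paraboloid_interp \<Delta> x - paraboloid_interp E x))"
proof -
  let ?D = "delaunay S" and ?h = paraboloid_interp
  note D = triangulation_of_delaunay[OF S]
  have cont: "continuous_on UNIV (?h \<Delta>)" if "triangulation_of S t" "\<Delta> \<in> t" for \<Delta> t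
    using continuous_paraboloid_interp triangulation_of_simplex(2)[OF that] by blast
  have "(\<Sum>\<Delta>\<in>t. integral \<Delta> (?h \<Delta>)) = (\<Sum>\<Delta>\<in>t. \<Sum>E\<in>?D. integral (\<Delta> \<inter> E) (?h \<Delta>))"
    using t D cont by (intro sum.cong refl integral_refine)
  moreover have "(\<Sum>E\<in>?D. integral E (?h E)) = (\<Sum>E\<in>?D. \<Sum>\<Delta>\<in>t. integral (E \<inter> \<Delta>) (?h E))"
    using t D cont by (intro sum.cong refl integral_refine)
  then have "(\<Sum>E\<in>?D. integral E (?h E)) = (\<Sum>\<Delta>\<in>t. \<Sum>E\<in>?D. integral (\<Delta> \<inter> E) (?h E))"
    by (subst (asm) sum.swap) (simp add: Int_commute)
  moreover have "integral (\<Delta> \<inter> E) (\<lambda>x. ?h \<Delta> x - ?h E x) =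
      integral (\<Delta> \<inter> E) (?h \<Delta>) - integral (\<Delta> \<inter> E) (?h E)" if "\<Delta> \<in> t" "E \<in> ?D" for \<Delta> E
    using triangulation_of_compact_convex(1)[OF t that(1)]
      triangulation_of_compact_convex(1)[OF D that(2)] cont[OF t that(1)] cont[OF D that(2)]
    by (intro integral_diff integrable_on_compact_continuous compact_Int)
  ultimately show ?thesis
    unfolding V_eq_integral[OF t] V_eq_integral[OF D]
    by (simp add: right_diff_distrib[symmetric] sum_subtractf cong: sum.cong)
qed

lemma delaunay_minimizes_V:
  fixes S :: "'a::euclidean_space set"
  assumes S: "generic S" and t: "triangulation_of S t"
  shows "V (delaunay S) \<le> V t" and "V t = V (delaunay S) \<Longrightarrow> t = delaunay S"
proof -
  let ?D = "delaunay S" and ?h = paraboloid_interp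
  let ?I = "\<lambda>\<Delta> E. integral (\<Delta> \<inter> E) (\<lambda>x. ?h \<Delta> x - ?h E x)"
  note D = triangulation_of_delaunay[OF S]
  have compact: "compact (\<Delta> \<inter> E)" if "\<Delta> \<in> t" "E \<in> ?D" for \<Delta> E
    using triangulation_of_compact_convex(1)[OF t that(1)]
      triangulation_of_compact_convex(1)[OF D that(2)] by (rule compact_Int)
  have cont: "continuous_on UNIV (\<lambda>x. ?h \<Delta> x - ?h E x)" if "\<Delta> \<in> t" "E \<in> ?D" for \<Delta> E
    using triangulation_of_simplex(2)[OF t that(1)] triangulation_of_simplex(2)[OF D that(2)]
    by (intro continuous_on_diff continuous_paraboloid_interp)
  have le: "0 \<le> ?h \<Delta> x - ?h E x" if "\<Delta> \<in> t" "E \<in> ?D" "x \<in> \<Delta>" for \<Delta> E x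
    using paraboloid_interp_delaunay_le[OF S t that] by simp
  have nonneg: "0 \<le> ?I \<Delta> E" if "\<Delta> \<in> t" "E \<in> ?D" for \<Delta> E
    using le[OF that] compact[OF that] cont[OF that]
    by (intro integral_nonneg integrable_on_compact_continuous) auto
  have "0 \<le> (\<Sum>\<Delta>\<in>t. \<Sum>E\<in>?D. ?I \<Delta> E)" using nonneg by (intro sum_nonneg)
  then have "0 \<le> V t - V ?D" unfolding V_diff_delaunay[OF S t] by simp
  then show "V ?D \<le> V t" by simp
  assume "V t = V ?D"
  then have zero: "(\<Sum>\<Delta>\<in>t. \<Sum>E\<in>?D. ?I \<Delta> E) = 0"
    using V_diff_delaunay[OF S t] by simp
  have zero: "?I \<Delta> E = 0" if \<Delta>E: "\<Delta> \<in> t" "E \<in> ?D" for \<Delta> E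
  proof -
    have "(\<Sum>E\<in>?D. ?I \<Delta> E) = 0"
      using zero \<Delta>E(1) nonneg triangulation_of_finite[OF t]
        sum_nonneg_eq_0_iff[of t "\<lambda>\<Delta>. \<Sum>E\<in>?D. ?I \<Delta> E"] by (simp add: sum_nonneg)
    then show ?thesis
      using \<Delta>E nonneg triangulation_of_finite[OF D] sum_nonneg_eq_0_iff[of ?D "?I \<Delta>"] by simp
  qed
  \<comment> \<open>Every overlap integral is 0, while distinct simplices with overlapping interiors
    would give a positive one.\<close>
  have eq: "\<Delta> = E" if \<Delta>E: "\<Delta> \<in> t" "E \<in> ?D" "interior (\<Delta> \<inter> E) \<noteq> {}" for \<Delta> E
  proof (rule ccontr)
    assume ne: "\<Delta> \<noteq> E"
    have "0 < ?I \<Delta> E"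
      using \<Delta>E(3)
    proof (rule integral_pos_if_interior[OF compact[OF \<Delta>E(1,2)] _ cont[OF \<Delta>E(1,2)]])
      show "0 \<le> ?h \<Delta> x - ?h E x" if "x \<in> \<Delta> \<inter> E" for x
        using le[OF \<Delta>E(1,2)] that by blast
      show "0 < ?h \<Delta> x - ?h E x" if "x \<in> interior (\<Delta> \<inter> E)" for x
        using paraboloid_interp_delaunay_less[OF S t \<Delta>E(1,2) _ ne, of x] that by simp
    qed
    with zero[OF \<Delta>E(1,2)] show False by simp
  qed
  show "t = ?D"
  proof
    show "t \<subseteq> ?D"
    proof
      fix \<Delta> assume \<Delta>: "\<Delta> \<in> t"
      obtain E where "E \<in> ?D" "interior (\<Delta> \<inter> E) \<noteq> {}"
        using triangulation_of_overlap_exists[OF t \<Delta> D] by blast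
      with eq[OF \<Delta>] show "\<Delta> \<in> ?D" by blast
    qed
    show "?D \<subseteq> t"
    proof
      fix E assume E: "E \<in> ?D"
      obtain \<Delta> where \<Delta>: "\<Delta> \<in> t" "interior (E \<inter> \<Delta>) \<noteq> {}"
        using triangulation_of_overlap_exists[OF D E t] by blast
      with eq[OF \<Delta>(1) E] show "E \<in> t" by (simp add: Int_commute)
    qed
  qed
qed

theorem theorem2:
  fixes S :: "(real ^ 'n) set" and t :: "(real ^ 'n) set set"
  assumes "generic S"
    and "triangulation_of S t"
  shows "is_arg_min V (triangulation_of S) t \<longleftrightarrow> t = delaunay S"
  \<comment> \<open>A minimizer cannot exceed the value at \<open>delaunay S\<close>, so the two
    values agree and the equality case identifies \<open>t\<close>; the converse is the
    inequality.\<close>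
  using delaunay_minimizes_V[OF assms(1)] triangulation_of_delaunay[OF assms(1)] assms(2)
  unfolding is_arg_min_def by (metis linorder_not_less order_antisym)

end
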